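(* Let $G$ be a graph with $n$ vertices. Then $\omega(G)\le \lfloor n^2/4\rfloor$.
   Context: Graphs are finite, undirected and simple. A representation of a graph $G$ by subsets of a set $X$ is a family $\{S_v: v\in V(G)\}$ of pairwise distinct nonempty subsets of $X$ such that for all distinct vertices $u,v$ one has $|S_u\cap S_v|=1$ if $u$ and $v$ are adjacent, and $|S_u\cap S_v|=0$ otherwise. The intersection number $\omega(G)$ is the minimum cardinality of a set $X$ such that $G$ has a representation by subsets of $X$.
   Formalization: The formal theorem excludes n = 1, 2, 3, where the claim fails as stated: the edgeless graph on n vertices needs n pairwise disjoint nonempty sets, so its intersection number is n, exceeding ⌊n²/4⌋. All other n, including n = 0, are covered. *)

theory Defs
  imports "Graph_Theory.Pair_Digraph"
begin

text \<open>
  Finite simple graphs are the symmetric loop-free pair digraphs of the locale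
  \<open>pair_graph\<close>: the vertex set is \<open>pverts G\<close>, and \<open>u\<close>, \<open>v\<close> are adjacent iff \<open>(u, v) \<in> parcs G\<close>.
\<close>

text \<open>
  \<open>X\<close> is required to be finite because \<open>card\<close> is \<open>0\<close> on infinite sets. Only finite sets
  matter for the intersection number of a finite graph (see \<open>representation_exists\<close> below).
\<close>

definition is_representation :: "'a pair_pre_digraph \<Rightarrow> 'b set \<Rightarrow> ('a \<Rightarrow> 'b set) \<Rightarrow> bool" where
  "is_representation G X S \<longleftrightarrow>
     finite X \<and>
     (\<forall>v\<in>pverts G. S v \<subseteq> X \<and> S v \<noteq> {}) \<and>
     inj_on S (pverts G) \<and>
     (\<forall>u\<in>pverts G. \<forall>v\<in>pverts G. u \<noteq> v \<longrightarrow>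
        card (S u \<inter> S v) = (if (u, v) \<in> parcs G then 1 else 0))"

text \<open>
  The ground set may be taken to consist of natural numbers, since every finite set is
  in bijection with such a set.
\<close>

definition intersection_number :: "'a pair_pre_digraph \<Rightarrow> nat" where
  "intersection_number G =
     (LEAST k. \<exists>(X :: nat set) S. is_representation G X S \<and> card X = k)"

lemma is_representation_image:
  assumes "is_representation G X S" "inj_on f X"
  shows "is_representation G (f ` X) (\<lambda>v. f ` S v)"
proof -
  have sub: "S v \<subseteq> X" if "v \<in> pverts G" for v
    using assms(1) that by (auto simp: is_representation_def)
  have "inj_on (\<lambda>v. f ` S v) (pverts G)"
  proof (rule inj_onI)
    fix u v assume uv: "u \<in> pverts G" "v \<in> pverts G" "f ` S u = f ` S v"
    then have "S u = S v"
      using inj_on_image_eq_iff[OF assms(2) sub sub] by blast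
    then show "u = v"
      using assms(1) uv by (auto simp: is_representation_def inj_on_def)
  qed
  moreover have "card (f ` S u \<inter> f ` S v) = card (S u \<inter> S v)"
    if "u \<in> pverts G" "v \<in> pverts G" for u v
  proof -
    have "f ` S u \<inter> f ` S v = f ` (S u \<inter> S v)"
      using inj_on_image_Int[OF assms(2) sub sub] that by simp
    moreover have "inj_on f (S u \<inter> S v)"
      using assms(2) sub[OF that(1)] by (meson inj_on_subset le_infI1)
    ultimately show ?thesis by (simp add: card_image)
  qed
  ultimately show ?thesis
    using assms(1) unfolding is_representation_def by (simp add: image_mono)
qed

text \<open>The minimum is attained: use all edges and all vertices as elements of \<open>X\<close>.\<close>

lemma representation_exists:
  assumes "pair_graph G"
  shows "\<exists>(X :: nat set) S. is_representation G X S"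
proof -
  interpret pair_graph G by fact
  let ?X = "Pow (pverts G)"
  let ?S = "\<lambda>v. insert {v} {{v, w} | w. (v, w) \<in> parcs G}"
  have sym: "(v, u) \<in> parcs G" if "(u, v) \<in> parcs G" for u v
    using pair_sym_arcs that by (auto simp: symmetric_def elim: symE)
  have nl: "(v, v) \<notin> parcs G" for v
    using pair_no_loops by fastforce
  have int: "?S u \<inter> ?S v = (if (u, v) \<in> parcs G then {{u, v}} else {})" if "u \<noteq> v" for u v
    using that sym nl by (auto simp: doubleton_eq_iff)
  have "is_representation G ?X ?S"
    unfolding is_representation_def
  proof (intro conjI ballI impI)
    show "inj_on ?S (pverts G)"
    proof (rule inj_onI, rule ccontr)
      fix u v assume "?S u = ?S v" "u \<noteq> v"
      then have "{u} \<in> ?S v" by blast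
      then show False using \<open>u \<noteq> v\<close> by (auto simp: doubleton_eq_iff)
    qed
  next
    fix u v :: 'a assume "u \<noteq> v"
    then show "card (?S u \<inter> ?S v) = (if (u, v) \<in> parcs G then 1 else 0)"
      unfolding int[OF \<open>u \<noteq> v\<close>] by simp
  qed (use pair_finite_verts in \<open>auto dest: in_arcsD2\<close>)
  moreover obtain f :: "'a set \<Rightarrow> nat" where "inj_on f ?X"
    using finite_imp_inj_to_nat_seg pair_finite_verts by (metis finite_Pow_iff)
  ultimately show ?thesis
    using is_representation_image by blast
qed

text \<open>
  The bound \<open>\<lfloor>n\<^sup>2 / 4\<rfloor>\<close> fails for \<open>n \<in> {1, 2, 3}\<close>: the edgeless graph on \<open>n\<close> vertices
  needs \<open>n\<close> elements.
\<close>

lemma edgeless_pair_graph: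
  "finite V \<Longrightarrow> pair_graph \<lparr> pverts = V, parcs = {} \<rparr>"
  by unfold_locales (auto simp: symmetric_def sym_def)

lemma edgeless_lower_bound:
  assumes "finite V"
  shows "card V \<le> intersection_number \<lparr> pverts = V, parcs = {} \<rparr>"
proof -
  let ?G = "\<lparr> pverts = V, parcs = {} \<rparr>"
  have "\<exists>(X :: nat set) S. is_representation ?G X S \<and> card X = intersection_number ?G"
    unfolding intersection_number_def
    by (rule LeastI_ex) (use representation_exists[OF edgeless_pair_graph[OF assms]] in blast)
  then obtain X :: "nat set" and S
    where S: "is_representation ?G X S" and X: "card X = intersection_number ?G" by blast
  have fin: "finite X" and sub: "S v \<subseteq> X" and ne: "S v \<noteq> {}" if "v \<in> V" for v
    using S that by (auto simp: is_representation_def)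
  have disj: "S u \<inter> S v = {}" if "u \<in> V" "v \<in> V" "u \<noteq> v" for u v
  proof -
    have "card (S u \<inter> S v) = 0"
      using S that by (auto simp: is_representation_def)
    moreover have "finite (S u \<inter> S v)"
      using fin[OF that(1)] sub[OF that(1)] by (meson finite_Int finite_subset)
    ultimately show ?thesis by simp
  qed
  define c where "c v = (SOME x. x \<in> S v)" for v
  have c: "c v \<in> S v" if "v \<in> V" for v
    using ne[OF that] unfolding c_def by (simp add: some_in_eq)
  have "inj_on c V"
    by (rule inj_onI) (metis c disj disjoint_iff)
  moreover have "c ` V \<subseteq> X" using c sub by blast
  moreover have "finite X" using S by (simp add: is_representation_def)
  ultimately show ?thesis using X by (metis card_inj_on_le)
qed

lemma bound_fails:
  assumes "card V \<in> {1, 2, 3}"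
  shows "(card V)\<^sup>2 div 4 < intersection_number \<lparr> pverts = V, parcs = {} \<rparr>"
proof -
  have "finite V" using assms by (metis card.infinite insertE singletonD zero_neq_numeral zero_neq_one)
  then show ?thesis using edgeless_lower_bound[of V] assms by auto
qed

end

theory Submission
  imports Defs
begin

text \<open>
  An element \<open>x\<close> of the ground set stands for the clique \<open>{v. x \<in> S v}\<close>, so a representation is
  a decomposition of the edges into cliques that also separates the vertices. As in the theorem
  of Erdos, Goodman and Posa on decompositions into edges and triangles, the
  bound is proved by removing a vertex \<open>v\<close> of minimum degree \<open>d\<close> and using
  \<open>\<lfloor>n\<^sup>2/4\<rfloor> - \<lfloor>(n-1)\<^sup>2/4\<rfloor> = \<lfloor>n/2\<rfloor>\<close>.

  Partition the neighbourhood of \<open>v\<close> into cliques, delete from the rest of the graph the edges inside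
  these cliques, and represent what remains. Each part, with \<open>v\<close> added, is a new clique,
  that is, a new element of the ground set; if \<open>v\<close> has no neighbours, one new element
  is given to \<open>v\<close> alone. The old sets stay distinct because they are distinct
  on the old elements, and the set of \<open>v\<close> is different from them because it has new elements
  only. So non-emptiness and distinctness survive each step at no cost
  (\<open>representable_insert_vertex\<close>), and only the number of parts matters.

  If \<open>d \<le> n/2\<close>, singletons suffice. Otherwise put \<open>r = d - \<lfloor>n/2\<rfloor>\<close>. Each neighbour of \<open>v\<close> has at
  least \<open>d - (n - d) \<ge> 2 r - 1\<close> neighbours inside the neighbourhood, so a greedy choice finds \<open>r\<close>
  disjoint edges there (\<open>greedy_matching\<close>), and these edges together with singletons form
  \<open>d - r = \<lfloor>n/2\<rfloor>\<close> parts.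

  The step gives the bound \<open>n\<close> for \<open>1 \<le> n \<le> 3\<close>, which exceeds \<open>\<lfloor>n\<^sup>2/4\<rfloor>\<close>; the excess has to disappear at
  \<open>n = 4\<close>. There, a vertex of degree at most \<open>1\<close> costs only one new element, and if
  all degrees are at least \<open>2\<close>, then the graph contains a 4-cycle and the neighbourhood of a vertex can
  be partitioned so that the remaining graph is a path on three vertices, which needs only two
  elements (\<open>representable_four_vertices\<close>).
\<close>

section \<open>Adding a vertex to a representation\<close>

text \<open>
  Vertices and arcs are separate arguments, and arcs at vertices outside \<open>V\<close> are allowed, so that
  deleting a vertex does not change the arcs.
\<close>

definition representable :: "'a set \<Rightarrow> ('a \<times> 'a) set \<Rightarrow> nat \<Rightarrow> bool" where
  "representable V E k \<longleftrightarrow>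
     (\<exists>(X :: nat set) S. is_representation \<lparr> pverts = V, parcs = E \<rparr> X S \<and> card X \<le> k)"

definition nbrs :: "'a set \<Rightarrow> ('a \<times> 'a) set \<Rightarrow> 'a \<Rightarrow> 'a set" where
  "nbrs V E v = {u \<in> V - {v}. (v, u) \<in> E}"

text \<open>A partition into cliques is given by a labelling whose classes are the cliques.\<close>

definition clique_labelling :: "('a \<times> 'a) set \<Rightarrow> 'a set \<Rightarrow> ('a \<Rightarrow> nat) \<Rightarrow> bool" where
  "clique_labelling E N c \<longleftrightarrow> (\<forall>u\<in>N. \<forall>w\<in>N. u \<noteq> w \<longrightarrow> c u = c w \<longrightarrow> (u, w) \<in> E)"

definition remove_classes ::
  "('a \<times> 'a) set \<Rightarrow> 'a set \<Rightarrow> ('a \<Rightarrow> nat) \<Rightarrow> ('a \<times> 'a) set" where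
  "remove_classes E N c = E - {(u, w). u \<in> N \<and> w \<in> N \<and> c u = c w}"

lemma sym_remove_classes: "sym E \<Longrightarrow> sym (remove_classes E N c)"
  by (auto simp: remove_classes_def sym_def)

lemma representable_mono: "representable V E k \<Longrightarrow> k \<le> l \<Longrightarrow> representable V E l"
  unfolding representable_def using le_trans by blast

lemma representable_empty: "representable {} E k"
  unfolding representable_def is_representation_def
  by (rule exI[of _ "{}"]) simp

text \<open>
  The labels in \<open>L\<close> become the new elements: \<open>v\<close> receives all of them, and a neighbour receives its
  own label. Two old vertices with a common label lose their old common element, because
  the edge between them was removed, and gain exactly one new one. An isolated \<open>v\<close> takes
  its element from a non-empty \<open>L\<close> whose labels belong to no neighbour.
\<close>

lemma representable_insert_vertex:
  assumes rep: "representable (V - {v}) (remove_classes E (nbrs V E v) c) k"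
    and v: "v \<in> V" and "sym E"
    and L: "finite L" "L \<noteq> {}" "c ` nbrs V E v \<subseteq> L"
    and cl: "clique_labelling E (nbrs V E v) c"
  shows "representable V E (k + card L)"
proof -
  let ?N = "nbrs V E v"
  let ?G = "\<lparr> pverts = V, parcs = E \<rparr>"
  obtain X :: "nat set" and S
    where S: "is_representation \<lparr> pverts = V - {v}, parcs = remove_classes E ?N c \<rparr> X S"
      and X: "card X \<le> k"
    using rep unfolding representable_def by blast
  have fin: "finite X" using S by (simp add: is_representation_def)
  have sub: "S u \<subseteq> X" and ne: "S u \<noteq> {}" if "u \<in> V" "u \<noteq> v" for u
    using S that by (auto simp: is_representation_def)
  have inj: "u = w" if "u \<in> V - {v}" "w \<in> V - {v}" "S u = S w" for u w
    using S that unfolding is_representation_def inj_on_def by simp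
  have crd: "card (S u \<inter> S w) = (if (u, w) \<in> remove_classes E ?N c then 1 else 0)"
    if "u \<in> V" "u \<noteq> v" "w \<in> V" "w \<noteq> v" "u \<noteq> w" for u w
    using S that by (simp add: is_representation_def)
  define T :: "'a \<Rightarrow> (nat + nat) set" where
    "T u = (if u = v then Inr ` L else Inl ` S u \<union> (if u \<in> ?N then {Inr (c u)} else {}))" for u
  define Y :: "(nat + nat) set" where "Y = Inl ` X \<union> Inr ` L"
  have old: "Inl -` T u = S u" if "u \<noteq> v" for u
    using that by (auto simp: T_def)
  have vN: "v \<notin> ?N" by (simp add: nbrs_def)
  have with_v: "card (T v \<inter> T u) = (if (v, u) \<in> E then 1 else 0)" if "u \<in> V" "u \<noteq> v" for u
  proof (cases "u \<in> ?N")
    case True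
    then have "T v \<inter> T u = {Inr (c u)}" using L(3) that by (auto simp: T_def)
    then show ?thesis using True by (simp add: nbrs_def)
  next
    case False
    then have "T v \<inter> T u = {}" using that by (auto simp: T_def)
    then show ?thesis using False that by (simp add: nbrs_def)
  qed
  have both_old: "card (T u \<inter> T w) = (if (u, w) \<in> E then 1 else 0)"
    if uw: "u \<in> V" "u \<noteq> v" "w \<in> V" "w \<noteq> v" "u \<noteq> w" for u w
  proof (cases "u \<in> ?N \<and> w \<in> ?N \<and> c u = c w")
    case True
    then have "card (S u \<inter> S w) = 0" using crd[OF uw] by (simp add: remove_classes_def)
    moreover have "finite (S u \<inter> S w)" using sub[OF uw(1,2)] fin by (meson finite_Int finite_subset)
    ultimately have "S u \<inter> S w = {}" by simp
    then have "T u \<inter> T w = {Inr (c u)}" using True uw by (auto simp: T_def)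
    moreover have "(u, w) \<in> E" using cl True uw by (simp add: clique_labelling_def)
    ultimately show ?thesis by simp
  next
    case False
    then have "T u \<inter> T w = Inl ` (S u \<inter> S w)" using uw by (auto simp: T_def)
    then have "card (T u \<inter> T w) = card (S u \<inter> S w)" by (simp add: card_image)
    then show ?thesis using crd[OF uw] False by (auto simp: remove_classes_def)
  qed
  have "is_representation ?G Y T"
    unfolding is_representation_def pair_pre_digraph.simps
  proof (intro conjI ballI impI)
    show "finite Y" using fin L by (simp add: Y_def)
  next
    fix u assume "u \<in> V"
    then show "T u \<subseteq> Y" using sub[of u] L(3) by (auto simp: T_def Y_def)
    show "T u \<noteq> {}" using ne[of u] \<open>u \<in> V\<close> L(2) by (auto simp: T_def)
  next
    have v_new: "T u \<noteq> T v" if "u \<in> V" "u \<noteq> v" for u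
      using ne[OF that] that by (auto simp: T_def)
    show "inj_on T V"
    proof (rule inj_onI)
      fix u w assume uw: "u \<in> V" "w \<in> V" "T u = T w"
      show "u = w"
      proof (cases "u = v \<or> w = v")
        case True
        then show ?thesis using v_new uw by metis
      next
        case False
        then have "S u = S w" using uw old by metis
        then show ?thesis using inj False uw by simp
      qed
    qed
  next
    fix u w assume uw: "u \<in> V" "w \<in> V" "u \<noteq> w"
    have "(u, v) \<in> E \<longleftrightarrow> (v, u) \<in> E" using \<open>sym E\<close> by (auto simp: sym_def)
    then show "card (T u \<inter> T w) = (if (u, w) \<in> E then 1 else 0)"
      using with_v both_old uw by (metis Int_commute)
  qed
  then have "is_representation ?G (to_nat ` Y) (\<lambda>u. to_nat ` T u)"
    by (rule is_representation_image) simp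
  moreover have "card (to_nat ` Y) \<le> k + card L"
  proof -
    have "card (to_nat ` Y) = card Y" by (simp add: card_image)
    also have "\<dots> \<le> card (Inl ` X :: (nat + nat) set) + card (Inr ` L :: (nat + nat) set)"
      unfolding Y_def by (rule card_Un_le)
    also have "\<dots> \<le> k + card L" using X by (simp add: card_image)
    finally show ?thesis .
  qed
  ultimately show ?thesis unfolding representable_def by blast
qed

section \<open>Partitioning a neighbourhood into few cliques\<close>

text \<open>
  As long as fewer than \<open>r\<close> edges have been chosen, they cover at most \<open>2 r - 2\<close> vertices. So any
  vertex not yet covered has a neighbour not yet covered, and the two form the next edge.
\<close>

lemma greedy_matching:
  assumes "finite N" "sym E" "2 * r \<le> card N"
    and deg: "\<And>u. u \<in> N \<Longrightarrow> 2 * r - 1 \<le> card (nbrs N E u)"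
    and "k \<le> r"
  shows "\<exists>M c. M \<subseteq> N \<and> card M = 2 * k \<and> clique_labelling E M c \<and> c ` M \<subseteq> {..<k}"
  using \<open>k \<le> r\<close>
proof (induction k)
  case 0
  then show ?case by (intro exI[of _ "{}"]) (simp add: clique_labelling_def)
next
  case (Suc k)
  then obtain M c where M: "M \<subseteq> N" "card M = 2 * k"
    and c: "clique_labelling E M c" "c ` M \<subseteq> {..<k}" by auto
  have finM: "finite M" using M(1) \<open>finite N\<close> by (rule finite_subset)
  have "card M < card N" using M(2) Suc.prems assms(3) by linarith
  then have "\<not> N \<subseteq> M" using card_mono[OF finM] by (meson not_le)
  then obtain u where u: "u \<in> N" "u \<notin> M" by blast
  have "card M < card (nbrs N E u)" using deg[OF u(1)] M(2) Suc.prems by linarith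
  then have "\<not> nbrs N E u \<subseteq> M" using card_mono[OF finM] by (meson not_le)
  then obtain w where w: "w \<in> N" "w \<notin> M" "w \<noteq> u" "(u, w) \<in> E" by (auto simp: nbrs_def)
  have "(w, u) \<in> E" using w(4) \<open>sym E\<close> by (simp add: sym_def)
  let ?M = "insert u (insert w M)" and ?c = "c(u := k, w := k)"
  have lt: "c x < k" if "x \<in> M" for x using c(2) that by auto
  then have lt': "c x \<noteq> k" if "x \<in> M" for x using that by blast
  have "card ?M = 2 * Suc k" using M finM u w by simp
  moreover have "?M \<subseteq> N" using M u w by simp
  moreover have "clique_labelling E ?M ?c"
    using c(1) lt' u w \<open>(w, u) \<in> E\<close> unfolding clique_labelling_def
    by (smt (verit, del_insts) fun_upd_apply insert_iff)
  moreover have "?c ` ?M \<subseteq> {..<Suc k}" using lt by (auto simp: less_Suc_eq)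
  ultimately show ?case by blast
qed

text \<open>The vertices outside the matching become singleton classes.\<close>

lemma clique_labelling_exists:
  assumes "finite N" "sym E" "2 * r \<le> card N"
    and "\<And>u. u \<in> N \<Longrightarrow> 2 * r - 1 \<le> card (nbrs N E u)"
  shows "\<exists>c. clique_labelling E N c \<and> c ` N \<subseteq> {..<card N - r}"
proof -
  obtain M c where M: "M \<subseteq> N" "card M = 2 * r"
    and c: "clique_labelling E M c" "c ` M \<subseteq> {..<r}"
    using greedy_matching[OF assms order.refl] by blast
  have "card (N - M) = card N - 2 * r"
    using M \<open>finite N\<close> by (simp add: card_Diff_subset finite_subset)
  then obtain h where h: "bij_betw h (N - M) {0..<card N - 2 * r}"
    using ex_bij_betw_finite_nat[of "N - M"] \<open>finite N\<close> by auto
  let ?c = "\<lambda>u. if u \<in> M then c u else r + h u"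
  have lt: "c u < r" if "u \<in> M" for u using c(2) that by auto
  have hlt: "h u < card N - 2 * r" if "u \<in> N" "u \<notin> M" for u
    using bij_betwE[OF h] that by auto
  have "clique_labelling E N ?c"
    unfolding clique_labelling_def
  proof (intro ballI impI)
    fix u w assume uw: "u \<in> N" "w \<in> N" "u \<noteq> w" "?c u = ?c w"
    have "\<not> (u \<notin> M \<and> w \<notin> M)"
    proof
      assume out: "u \<notin> M \<and> w \<notin> M"
      then have "h u = h w" using uw(4) by simp
      then show False using inj_onD[OF bij_betw_imp_inj_on[OF h], of u w] uw(1-3) out by simp
    qed
    then have "u \<in> M \<and> w \<in> M" using uw(4) lt[of u] lt[of w] by (auto split: if_splits)
    then show "(u, w) \<in> E" using uw c(1) by (auto simp: clique_labelling_def)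
  qed
  moreover have "?c u < card N - r" if "u \<in> N" for u
    using lt[of u] hlt[of u] that assms(3) by (cases "u \<in> M") auto
  ultimately show ?thesis by (metis (no_types, lifting) image_subsetI lessThan_iff)
qed

text \<open>
  At most \<open>card V - d\<close> of the neighbours of a vertex of the neighbourhood lie outside that
  neighbourhood, where \<open>d\<close> is the minimum degree. That leaves enough inside to
  match \<open>d - card V div 2\<close> pairs.
\<close>

lemma min_degree_clique_labelling:
  assumes "finite V" "sym E" "v \<in> V"
    and min: "\<And>u. u \<in> V \<Longrightarrow> card (nbrs V E v) \<le> card (nbrs V E u)"
  shows "\<exists>c. clique_labelling E (nbrs V E v) c \<and> c ` nbrs V E v \<subseteq> {..<card V div 2}"
proof -
  let ?N = "nbrs V E v" and ?m = "card V div 2"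
  let ?r = "card ?N - ?m"
  have NV: "?N \<subseteq> V - {v}" by (auto simp: nbrs_def)
  have finN: "finite ?N" using NV \<open>finite V\<close> by (meson finite_Diff finite_subset)
  have "card ?N \<le> card (V - {v})" using NV \<open>finite V\<close> by (simp add: card_mono)
  then have less: "card ?N < card V"
    using \<open>finite V\<close> \<open>v \<in> V\<close> by (metis card_Diff1_less le_less_trans)
  have "2 * ?r \<le> card ?N" using less by linarith
  moreover have "2 * ?r - 1 \<le> card (nbrs ?N E u)" if u: "u \<in> ?N" for u
  proof -
    have finn: "finite (nbrs ?N E u)" by (rule finite_subset[OF _ finN]) (auto simp: nbrs_def)
    have "nbrs V E u \<subseteq> nbrs ?N E u \<union> (V - ?N)" by (auto simp: nbrs_def)
    then have "card (nbrs V E u) \<le> card (nbrs ?N E u \<union> (V - ?N))"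
      using finn \<open>finite V\<close> by (intro card_mono) auto
    also have "\<dots> \<le> card (nbrs ?N E u) + card (V - ?N)" by (rule card_Un_le)
    also have "card (V - ?N) = card V - card ?N"
      using NV finN by (intro card_Diff_subset) auto
    finally have "card ?N \<le> card (nbrs ?N E u) + (card V - card ?N)"
      using min[of u] u NV by fastforce
    then show ?thesis using less by linarith
  qed
  ultimately obtain c where c: "clique_labelling E ?N c" "c ` ?N \<subseteq> {..<card ?N - ?r}"
    using clique_labelling_exists[OF finN \<open>sym E\<close>] by blast
  have "{..<card ?N - ?r} \<subseteq> {..<?m}" by auto
  then have "c ` ?N \<subseteq> {..<?m}" by (rule subset_trans[OF c(2)])
  then show ?thesis using c(1) by (intro exI[of _ c] conjI)
qed

lemma min_degree_vertex:
  assumes "finite V" "V \<noteq> {}"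
  obtains v where "v \<in> V" "\<And>u. u \<in> V \<Longrightarrow> card (nbrs V E v) \<le> card (nbrs V E u)"
  using ex_is_arg_min_if_finite[OF assms, of "\<lambda>v. card (nbrs V E v)"]
  by (auto simp: is_arg_min_linorder)

text \<open>
  The maximum with \<open>1\<close> matters for a single vertex only, where \<open>card V div 2\<close> would be \<open>0\<close>
  but the vertex still needs an element.
\<close>

lemma representable_step:
  assumes V: "finite V" "card V = Suc n" and "sym E"
    and IH: "\<And>W F. finite (W :: 'a set) \<Longrightarrow> card W = n \<Longrightarrow> sym F \<Longrightarrow> representable W F k"
  shows "representable (V :: 'a set) E (k + max 1 (Suc n div 2))"
proof -
  have "V \<noteq> {}" using V by auto
  then obtain v where v: "v \<in> V"
    and min: "\<And>u. u \<in> V \<Longrightarrow> card (nbrs V E v) \<le> card (nbrs V E u)"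
    using min_degree_vertex[OF V(1)] by blast
  obtain c where c: "clique_labelling E (nbrs V E v) c"
    "c ` nbrs V E v \<subseteq> {..<Suc n div 2}"
    using min_degree_clique_labelling[OF V(1) \<open>sym E\<close> v min] V(2) by auto
  have "representable (V - {v}) (remove_classes E (nbrs V E v) c) k"
    using V v \<open>sym E\<close> by (intro IH) (simp_all add: sym_remove_classes)
  moreover have "c ` nbrs V E v \<subseteq> {..<max 1 (Suc n div 2)}"
    using c(2) by (rule subset_trans) auto
  moreover have "{..<max 1 (Suc n div 2)} \<noteq> {}"
    by (simp add: lessThan_empty_iff)
  ultimately have "representable V E (k + card {..<max 1 (Suc n div 2)})"
    using v \<open>sym E\<close> c(1) by (intro representable_insert_vertex[where c = c and v = v]) auto
  then show ?thesis by simp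
qed

section \<open>Small graphs\<close>

lemma representable_upto_three_vertices:
  assumes "finite (V :: 'a set)" "card V = n" "sym E" "n \<le> 3"
  shows "representable V E n"
  using assms
proof (induction n arbitrary: V E)
  case 0
  then show ?case by (simp add: representable_empty)
next
  case (Suc n)
  have "representable V E (n + max 1 (Suc n div 2))"
    using Suc by (intro representable_step) auto
  moreover have "max 1 (Suc n div 2) = 1" using Suc.prems by auto
  ultimately show ?case by simp
qed

lemma representable_path:
  assumes "a \<noteq> b" "a \<noteq> c" "b \<noteq> c" "sym E" "(a, c) \<in> E" "(b, c) \<in> E" "(a, b) \<notin> E"
  shows "representable {a, b, c} E 2"
proof -
  define S :: "'a \<Rightarrow> nat set" where
    "S x = (if x = a then {0} else if x = b then {1} else {0, 1})" for x
  have "(c, a) \<in> E" "(c, b) \<in> E" "(b, a) \<notin> E" using assms by (meson symD)+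
  then have "is_representation \<lparr> pverts = {a, b, c}, parcs = E \<rparr> {0, 1} S"
    using assms unfolding is_representation_def inj_on_def S_def by auto
  then show ?thesis unfolding representable_def by (intro exI[of _ "{0, 1}"] exI) auto
qed

text \<open>
  If all degrees are at least \<open>2\<close>, let \<open>x\<close> be a vertex not adjacent to \<open>v\<close>, or any other vertex if the
  graph is complete. The remaining vertices \<open>a\<close> and \<open>b\<close> are adjacent to both \<open>v\<close> and \<open>x\<close>.
  Putting \<open>a\<close> and \<open>b\<close> in one class whenever they are adjacent leaves the path \<open>a\<close>, \<open>x\<close>, \<open>b\<close>, so the
  whole graph needs \<open>2 + 2\<close> elements.
\<close>

lemma representable_four_vertices:
  assumes V: "finite (V :: 'a set)" "card V = 4" and "sym E"
  shows "representable V E 4"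
proof -
  have "V \<noteq> {}" using V by auto
  then obtain v where v: "v \<in> V"
    and min: "\<And>u. u \<in> V \<Longrightarrow> card (nbrs V E v) \<le> card (nbrs V E u)"
    using min_degree_vertex[OF V(1)] by blast
  let ?N = "nbrs V E v"
  have NV: "?N \<subseteq> V - {v}" by (auto simp: nbrs_def)
  have finN: "finite ?N" using NV V(1) by (meson finite_Diff finite_subset)
  have card3: "card (V - {v}) = 3" using V v by simp
  show ?thesis
  proof (cases "card ?N \<le> 1")
    case True
    have "clique_labelling E ?N (\<lambda>_. 0)"
      using True finN by (auto simp: clique_labelling_def card_le_Suc0_iff_eq)
    moreover have "representable (V - {v}) (remove_classes E ?N (\<lambda>_. 0)) 3"
      using V card3 \<open>sym E\<close>
      by (intro representable_upto_three_vertices) (simp_all add: sym_remove_classes)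
    ultimately have "representable V E (3 + card {0::nat})"
      using v \<open>sym E\<close> by (intro representable_insert_vertex) auto
    then show ?thesis by simp
  next
    case False
    obtain x where x: "x \<in> V" "x \<noteq> v" "x \<in> ?N \<Longrightarrow> ?N = V - {v}"
    proof (cases "?N = V - {v}")
      case True
      then show ?thesis using that card3 by (metis DiffE card.empty equals0I singletonI zero_neq_numeral)
    next
      case False
      then show ?thesis using that NV by blast
    qed
    have "card (V - {v} - {x}) = 2" using card3 V(1) x by simp
    then obtain a b where ab: "V - {v} - {x} = {a, b}" "a \<noteq> b" by (meson card_2_iff)
    have Veq: "V - {v} = {a, b, x}" and ab_ne: "a \<noteq> x" "b \<noteq> x" "a \<noteq> v" "b \<noteq> v"
      using ab x by blast+
    have symE: "(u, w) \<in> E \<longleftrightarrow> (w, u) \<in> E" for u w using \<open>sym E\<close> by (auto simp: sym_def)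
    have full: "A = {a, b}" if "A \<subseteq> {a, b}" "2 \<le> card A" for A
      using that ab(2) by (intro card_seteq) auto
    have abN: "a \<in> ?N \<and> b \<in> ?N"
    proof (cases "x \<in> ?N")
      case True
      then show ?thesis using x(3) Veq by blast
    next
      case False
      then have "?N = {a, b}" using NV Veq \<open>\<not> card ?N \<le> 1\<close> by (intro full) auto
      then show ?thesis by simp
    qed
    have complete: "(y, z) \<in> E" if "x \<in> ?N" "y \<in> V" "z \<in> V" "y \<noteq> z" for y z
    proof -
      have "card (V - {y}) \<le> card (nbrs V E y)"
        using min[OF that(2)] x(3)[OF that(1)] card3 V that(2) by simp
      then have "nbrs V E y = V - {y}"
        using V(1) by (intro card_seteq) (auto simp: nbrs_def)
      then have "z \<in> nbrs V E y" using that by blast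
      then show ?thesis by (simp add: nbrs_def)
    qed
    have abV: "a \<in> V" "b \<in> V" using ab by blast+
    have xE: "(a, x) \<in> E \<and> (b, x) \<in> E"
    proof (cases "x \<in> ?N")
      case True
      then show ?thesis using complete abV x ab_ne by blast
    next
      case False
      then have "(x, v) \<notin> E" using x symE by (simp add: nbrs_def)
      then have "nbrs V E x \<subseteq> {a, b}" using Veq by (auto simp: nbrs_def)
      moreover have "2 \<le> card (nbrs V E x)" using min[OF x(1)] \<open>\<not> card ?N \<le> 1\<close> by linarith
      ultimately have "nbrs V E x = {a, b}" by (rule full)
      then have "a \<in> nbrs V E x" "b \<in> nbrs V E x" by simp_all
      then show ?thesis using symE by (simp add: nbrs_def)
    qed
    define c :: "'a \<Rightarrow> nat" where
      "c y = (if y = a \<or> y = b \<and> (a, b) \<in> E then 0 else 1)" for y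
    \<comment> \<open>The classes of \<open>b\<close> and \<open>x\<close> never meet: if \<open>x\<close> is a neighbour of \<open>v\<close>, the graph is complete,
      and \<open>b\<close> has the label \<open>0\<close>.\<close>
    have bx: "x \<notin> ?N" if "(a, b) \<notin> E" using complete abV ab(2) that by blast
    have "clique_labelling E ?N c"
      unfolding clique_labelling_def
    proof (intro ballI impI)
      fix u w assume uw: "u \<in> ?N" "w \<in> ?N" "u \<noteq> w" "c u = c w"
      then have "u \<in> {a, b, x}" "w \<in> {a, b, x}" using NV Veq by blast+
      then show "(u, w) \<in> E" using uw bx ab ab_ne symE by (auto simp: c_def split: if_splits)
    qed
    moreover have "representable (V - {v}) (remove_classes E ?N c) 2"
      unfolding Veq
    proof (rule representable_path)
      show "(a, b) \<notin> remove_classes E ?N c"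
        using abN by (auto simp: remove_classes_def c_def)
      show "(a, x) \<in> remove_classes E ?N c" "(b, x) \<in> remove_classes E ?N c"
        using xE bx ab_ne by (auto simp: remove_classes_def c_def)
    qed (use ab ab_ne \<open>sym E\<close> in \<open>auto simp: sym_remove_classes\<close>)
    ultimately have "representable V E (2 + card {0::nat, 1})"
      using v \<open>sym E\<close> by (intro representable_insert_vertex) (auto simp: c_def)
    then show ?thesis by simp
  qed
qed

section \<open>The bound for all larger graphs\<close>

lemma quarter_square_Suc: "(Suc n)\<^sup>2 div 4 = n\<^sup>2 div 4 + Suc n div 2"
proof (cases "even n")
  case True
  then obtain m where "n = 2 * m" by blast
  moreover have "(Suc (2 * m))\<^sup>2 = 1 + 4 * (m\<^sup>2 + m)" by (simp add: power2_eq_square)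
  ultimately show ?thesis by (simp add: power_mult_distrib)
next
  case False
  then obtain m where "n = 2 * m + 1" by (rule oddE)
  moreover have "(2 * m + 1)\<^sup>2 = 1 + 4 * (m\<^sup>2 + m)" by (simp add: power2_eq_square)
  moreover have "(2 * m + 2)\<^sup>2 = 4 * (m\<^sup>2 + m + (m + 1))" by (simp add: power2_eq_square)
  ultimately show ?thesis by simp
qed

lemma representable_quarter_square:
  assumes "4 \<le> n" "finite (V :: 'a set)" "card V = n" "sym E"
  shows "representable V E (n\<^sup>2 div 4)"
  using assms
proof (induction n arbitrary: V E rule: dec_induct)
  case base
  then show ?case using representable_four_vertices by simp
next
  case (step n)
  then have "representable V E (n\<^sup>2 div 4 + max 1 (Suc n div 2))"
    by (intro representable_step) auto
  moreover have "max 1 (Suc n div 2) = Suc n div 2" using step.hyps by auto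
  ultimately show ?case by (simp only: quarter_square_Suc)
qed

theorem theorem2p4:
  fixes G :: "'a pair_pre_digraph" and n :: nat
  assumes "pair_graph G"
    and "card (pverts G) = n"
    and "n \<notin> {1, 2, 3}"
  shows "intersection_number G \<le> n\<^sup>2 div 4"
proof -
  interpret pair_graph G by fact
  have sym: "sym (parcs G)" using pair_sym_arcs by (simp add: symmetric_def)
  have "representable (pverts G) (parcs G) (n\<^sup>2 div 4)"
  proof (cases "n = 0")
    case True
    then show ?thesis using assms(2) pair_finite_verts by (simp add: representable_empty)
  next
    case False
    then show ?thesis
      using assms sym pair_finite_verts by (intro representable_quarter_square) auto
  qed
  moreover have "\<lparr>pverts = pverts G, parcs = parcs G\<rparr> = G" by (cases G) simp
  ultimately have "\<exists>(X :: nat set) S. is_representation G X S \<and> card X \<le> n\<^sup>2 div 4"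
    by (simp only: representable_def)
  then obtain X :: "nat set" and S where "is_representation G X S" "card X \<le> n\<^sup>2 div 4"
    by blast
  moreover have "intersection_number G \<le> card X"
    unfolding intersection_number_def using calculation by (intro Least_le) blast
  ultimately show ?thesis by linarith
qed

end
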